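(* Let $\bar\rho>0$, $\bar u\in\mathbb{R}$, $\bar c>0$, $\bar\sigma>0$, $\delta x,\delta t>0$, $\lambda_1=\delta t/\delta x$, and $Q=\lambda_1 q\,\mathrm{Id}$. The difference approximation of the linearized Euler–Korteweg system that is second order accurate in space (MUSCL with Lax–Friedrichs type fluxes), $$\frac{dv_j}{dt}=\frac{A(v_{j+2}-6v_{j+1}+6v_{j-1}-v_{j-2})}{8\delta x}+\frac{Q}{2\delta t}\,\frac{-v_{j+2}+4v_{j+1}-6v_j+4v_{j-1}-v_{j-2}}{8}+\frac{B}{2\delta x^3}(v_{j+2}-2v_{j+1}+2v_{j-1}-v_{j-2}),$$ $j\in\mathbb{Z}$, with Crank–Nicolson time discretization, is Von Neumann stable for all $Q\ge0$ (that is, for all $q\ge0$).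
   Context: The linearization of the one-dimensional Euler–Korteweg system about the constant state $(\rho,\rho u)=(\bar\rho,\bar\rho\bar u)$ is $\partial_t v+A\partial_x v=B\partial_{xxx}v$, $v\in\mathbb{R}^2$, with $$A=\begin{pmatrix}0&1\\ \bar c^2-\bar u^2&2\bar u\end{pmatrix},\qquad B=\begin{pmatrix}0&0\\ \bar\sigma&0\end{pmatrix}.$$ Here $\bar c=\sqrt{P'(\bar\rho)}$ ($P$ is the pressure, $P'>0$) and $\bar\sigma=\bar\rho\kappa(\bar\rho)$ ($\kappa>0$ is the capillary coefficient). With the Fourier transform $\hat v(\theta)=\sum_k e^{ik\theta}v_k$ and the variable $\xi=2\sin(\theta/2)/\delta x\in[-2/\delta x,2/\delta x]$, the semi-discrete scheme becomes $\frac{d\hat v}{dt}=i\xi\mathcal{M}(\xi,\delta x)\hat v$ with $$\mathcal{M}(\xi,\delta x)=\zeta\left(\Big(1+\frac{\xi^2\delta x^2}{4}\Big)A+\xi^2B\right)+i\xi\,\frac{\xi^2\delta x^4}{16\,\delta t}Q,\qquad \zeta=\sqrt{1-\tfrac{(\xi\delta x)^2}{4}}.$$ The Crank–Nicolson time discretization is $$\hat v^{n+1}=\left(\mathrm{Id}-\frac{i\xi\delta t}{2}\mathcal{M}(\xi,\delta x)\right)^{-1}\left(\mathrm{Id}+\frac{i\xi\delta t}{2}\mathcal{M}(\xi,\delta x)\right)\hat v^n .$$ It is Von Neumann stable if, for every $\xi\in[-2/\delta x,2/\delta x]$, this amplification matrix is well defined and all its eigenvalues have modulus at most $1$. *)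

theory Defs
  imports "HOL-Analysis.Analysis"
begin

section \<open>The linearized Euler--Korteweg system and its semi-discretization\<close>

definition ek_A :: "real \<Rightarrow> real \<Rightarrow> real^2^2" where
  "ek_A c u = vector [vector [0, 1], vector [c\<^sup>2 - u\<^sup>2, 2 * u]]"

definition ek_B :: "real \<Rightarrow> real^2^2" where
  "ek_B \<sigma> = vector [vector [0, 0], vector [\<sigma>, 0]]"

definition muscl_scheme ::
  "real^2^2 \<Rightarrow> real^2^2 \<Rightarrow> real^2^2 \<Rightarrow> real \<Rightarrow> real \<Rightarrow> (int \<Rightarrow> real^2) \<Rightarrow> int \<Rightarrow> real^2" where
  "muscl_scheme A B Q dx dt v j =
     (1 / (8 * dx)) *\<^sub>R (A *v (v (j+2) - 6 *\<^sub>R v (j+1) + 6 *\<^sub>R v (j-1) - v (j-2)))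
   + (1 / (2 * dt)) *\<^sub>R (Q *v ((1/8) *\<^sub>R
        (- v (j+2) + 4 *\<^sub>R v (j+1) - 6 *\<^sub>R v j + 4 *\<^sub>R v (j-1) - v (j-2))))
   + (1 / (2 * dx ^ 3)) *\<^sub>R (B *v (v (j+2) - 2 *\<^sub>R v (j+1) + 2 *\<^sub>R v (j-1) - v (j-2)))"


section \<open>Von Neumann stability of the Crank--Nicolson discretization\<close>

definition lattice_fourier :: "(int \<Rightarrow> real^2) \<Rightarrow> real \<Rightarrow> complex^2" where
  "lattice_fourier v \<theta> = (\<chi> i. \<Sum>\<^sub>\<infinity>k. cis (of_int k * \<theta>) * complex_of_real (v k $ i))"

text \<open>For a translation-invariant operator \<open>L\<close> the semi-discrete system \<open>dv/dt = L v\<close> becomes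
  \<open>dw/dt = S(\<theta>) w\<close> for the Fourier transform \<open>w\<close> of \<open>v\<close>, where the columns of the matrix
  \<open>S(\<theta>)\<close> are the transforms of the responses of \<open>L\<close> to unit impulses at the origin.
  For the scheme above this is proved in \<open>lattice_fourier_muscl_scheme\<close> below.\<close>

definition fourier_symbol ::
  "((int \<Rightarrow> real^2) \<Rightarrow> int \<Rightarrow> real^2) \<Rightarrow> real \<Rightarrow> complex^2^2" where
  "fourier_symbol L \<theta> =
     (\<chi> i l. lattice_fourier (L (\<lambda>k. if k = 0 then axis l 1 else 0)) \<theta> $ i)"

definition is_eigenvalue :: "complex^2^2 \<Rightarrow> complex \<Rightarrow> bool" where
  "is_eigenvalue G \<mu> \<longleftrightarrow> (\<exists>w. w \<noteq> 0 \<and> G *v w = \<mu> *s w)"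

text \<open>The frequency variable \<open>\<xi> = 2 sin(\<theta>/2)/dx\<close> in \<open>[-2/dx, 2/dx]\<close> corresponds to
  \<open>\<theta> = 2 arcsin(\<xi> dx/2)\<close> in \<open>[-\<pi>, \<pi>]\<close>. At this frequency the symbol is \<open>\<i> \<xi> M(\<xi>, dx)\<close>
  (see \<open>fourier_symbol_muscl_scheme\<close> below), so that the amplification matrix is
  \<open>(Id - (\<i> \<xi> dt/2) M)^(-1) (Id + (\<i> \<xi> dt/2) M)\<close>; it is well defined when the first
  factor is the inverse of an invertible matrix.\<close>

definition cn_implicit_part :: "real \<Rightarrow> complex^2^2 \<Rightarrow> complex^2^2" where
  "cn_implicit_part dt S = mat 1 - (dt / 2) *\<^sub>R S"

definition cn_amplification :: "real \<Rightarrow> complex^2^2 \<Rightarrow> complex^2^2" where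
  "cn_amplification dt S = matrix_inv (cn_implicit_part dt S) ** (mat 1 + (dt / 2) *\<^sub>R S)"

definition cn_von_neumann_stable ::
  "real \<Rightarrow> real \<Rightarrow> ((int \<Rightarrow> real^2) \<Rightarrow> int \<Rightarrow> real^2) \<Rightarrow> bool" where
  "cn_von_neumann_stable dx dt L \<longleftrightarrow>
     (\<forall>\<xi>\<in>{- 2 / dx..2 / dx}.
        let S = fourier_symbol L (2 * arcsin (\<xi> * dx / 2)) in
          invertible (cn_implicit_part dt S) \<and>
          (\<forall>\<mu>. is_eigenvalue (cn_amplification dt S) \<mu> \<longrightarrow> cmod \<mu> \<le> 1))"


section \<open>The symbol of the scheme\<close>

definition ek_M ::
  "real^2^2 \<Rightarrow> real^2^2 \<Rightarrow> real^2^2 \<Rightarrow> real \<Rightarrow> real \<Rightarrow> real \<Rightarrow> complex^2^2" where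
  "ek_M A B Q dt \<xi> dx =
     (let \<zeta> = sqrt (1 - (\<xi> * dx)\<^sup>2 / 4) in
      \<chi> i l. complex_of_real (\<zeta> * ((1 + \<xi>\<^sup>2 * dx\<^sup>2 / 4) * A $ i $ l + \<xi>\<^sup>2 * B $ i $ l))
           + \<i> * complex_of_real (\<xi> * (\<xi>\<^sup>2 * dx ^ 4 / (16 * dt)) * Q $ i $ l))"

definition muscl_multiplier ::
  "real^2^2 \<Rightarrow> real^2^2 \<Rightarrow> real^2^2 \<Rightarrow> real \<Rightarrow> real \<Rightarrow> real \<Rightarrow> complex^2^2" where
  "muscl_multiplier A B Q dx dt \<theta> = (\<chi> i l.
       of_real (A $ i $ l / (8 * dx)) *
         (cis (- 2 * \<theta>) - 6 * cis (- \<theta>) + 6 * cis \<theta> - cis (2 * \<theta>))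
     + of_real (Q $ i $ l / (16 * dt)) *
         (- cis (- 2 * \<theta>) + 4 * cis (- \<theta>) - 6 + 4 * cis \<theta> - cis (2 * \<theta>))
     + of_real (B $ i $ l / (2 * dx ^ 3)) *
         (cis (- 2 * \<theta>) - 2 * cis (- \<theta>) + 2 * cis \<theta> - cis (2 * \<theta>)))"

lemma lattice_fourier_has_sum:
  fixes v :: "int \<Rightarrow> real^2"
  assumes "(\<lambda>k. norm (v k)) summable_on UNIV"
  shows "((\<lambda>k. cis (of_int k * \<theta>) * complex_of_real (v k $ i))
            has_sum (lattice_fourier v \<theta> $ i)) UNIV"
proof -
  have "(\<lambda>k. norm (cis (of_int k * \<theta>) * complex_of_real (v k $ i))) summable_on UNIV"
    by (rule summable_on_comparison_test[OF assms])
       (simp_all add: norm_mult component_le_norm_cart)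
  then have "(\<lambda>k. cis (of_int k * \<theta>) * complex_of_real (v k $ i)) summable_on UNIV"
    by (rule abs_summable_summable)
  then show ?thesis
    by (simp add: lattice_fourier_def has_sum_infsum)
qed

lemma lattice_fourier_shift_has_sum:
  fixes v :: "int \<Rightarrow> real^2"
  assumes "(\<lambda>k. norm (v k)) summable_on UNIV"
  shows "((\<lambda>k. cis (of_int k * \<theta>) * complex_of_real (v (k + m) $ i))
            has_sum (cis (- of_int m * \<theta>) * lattice_fourier v \<theta> $ i)) UNIV"
proof -
  let ?f = "\<lambda>k. cis (of_int k * \<theta>) * complex_of_real (v k $ i)"
  have bij: "bij_betw (\<lambda>k::int. k + m) UNIV UNIV"
    by (rule bij_betwI[where g = "\<lambda>k. k - m"]) auto
  have "((\<lambda>k. ?f (k + m)) has_sum (lattice_fourier v \<theta> $ i)) UNIV"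
    using lattice_fourier_has_sum[OF assms, of \<theta> i]
    by (subst has_sum_reindex_bij_betw[OF bij, of ?f])
  then have "((\<lambda>k. cis (- of_int m * \<theta>) * ?f (k + m))
      has_sum (cis (- of_int m * \<theta>) * lattice_fourier v \<theta> $ i)) UNIV"
    by (rule has_sum_cmult_right)
  moreover have "cis (- of_int m * \<theta>) * ?f (k + m)
      = cis (of_int k * \<theta>) * complex_of_real (v (k + m) $ i)" for k
  proof -
    have "cis (- of_int m * \<theta>) * cis (of_int (k + m) * \<theta>) = cis (of_int k * \<theta>)"
      by (simp add: cis_mult algebra_simps)
    then show ?thesis by (metis mult.assoc)
  qed
  ultimately show ?thesis by (simp only:)
qed

lemma lattice_fourier_muscl_multiplier:
  fixes v :: "int \<Rightarrow> real^2"
  assumes v: "(\<lambda>k. norm (v k)) summable_on UNIV"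
  shows "lattice_fourier (muscl_scheme A B Q dx dt v) \<theta>
       = muscl_multiplier A B Q dx dt \<theta> *v lattice_fourier v \<theta>"
proof (subst vec_eq_iff, intro allI)
  fix i :: 2
  define a where "a l = A $ i $ l / (8 * dx)" for l
  define q where "q l = Q $ i $ l / (16 * dt)" for l
  define b where "b l = B $ i $ l / (2 * dx ^ 3)" for l
  define g where "g m l k = cis (of_int k * \<theta>) * complex_of_real (v (k + m) $ l)" for m l k
  define F where "F l = lattice_fourier v \<theta> $ l" for l
  define G where "G m l = cis (- of_int m * \<theta>) * F l" for m l
  define comb where "comb l x2 x1 x0 y1 y2 =
      of_real (a l) * (x2 + (- 6) * x1 + 6 * y1 + (- 1) * y2)
    + of_real (q l) * ((- 1) * x2 + 4 * x1 + (- 6) * x0 + 4 * y1 + (- 1) * y2)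
    + of_real (b l) * (x2 + (- 2) * x1 + 2 * y1 + (- 1) * y2)"
    for l and x2 x1 x0 y1 y2 :: complex
  have sh: "(g m l has_sum G m l) UNIV" for m l
    unfolding g_def G_def F_def by (rule lattice_fourier_shift_has_sum[OF v])
  have h: "((\<lambda>k. comb l (g 2 l k) (g 1 l k) (g 0 l k) (g (- 1) l k) (g (- 2) l k))
      has_sum comb l (G 2 l) (G 1 l) (G 0 l) (G (- 1) l) (G (- 2) l)) UNIV" for l
    unfolding comb_def by (intro has_sum_add has_sum_cmult_right sh)
  have comb_mult: "comb l (c * x2) (c * x1) (c * x0) (c * y1) (c * y2) = c * comb l x2 x1 x0 y1 y2"
    for l c x2 x1 x0 y1 y2
    unfolding comb_def by (simp add: algebra_simps)
  have muscl: "complex_of_real (muscl_scheme A B Q dx dt v k $ i) =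
      (\<Sum>l\<in>UNIV. comb l (of_real (v (k + 2) $ l)) (of_real (v (k + 1) $ l)) (of_real (v (k + 0) $ l))
         (of_real (v (k + - 1) $ l)) (of_real (v (k + - 2) $ l)))" for k
  proof -
    have a': "(\<Sum>l\<in>UNIV. a l * w l) = (1 / (8 * dx)) * (\<Sum>l\<in>UNIV. A $ i $ l * w l)" for w
      by (simp add: a_def sum_distrib_left)
    have q': "(\<Sum>l\<in>UNIV. q l * w l)
        = (1 / (2 * dt)) * (\<Sum>l\<in>UNIV. Q $ i $ l * (1 / 8 * w l))" for w
      by (simp add: q_def sum_distrib_left)
    have b': "(\<Sum>l\<in>UNIV. b l * w l) = (1 / (2 * dx ^ 3)) * (\<Sum>l\<in>UNIV. B $ i $ l * w l)" for w
      by (simp add: b_def sum_distrib_left)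
    have "muscl_scheme A B Q dx dt v k $ i =
        (\<Sum>l\<in>UNIV. a l * (v (k + 2) $ l - 6 * v (k + 1) $ l + 6 * v (k - 1) $ l - v (k - 2) $ l))
      + (\<Sum>l\<in>UNIV. q l * (- v (k + 2) $ l + 4 * v (k + 1) $ l - 6 * v k $ l
           + 4 * v (k - 1) $ l - v (k - 2) $ l))
      + (\<Sum>l\<in>UNIV. b l * (v (k + 2) $ l - 2 * v (k + 1) $ l + 2 * v (k - 1) $ l - v (k - 2) $ l))"
      unfolding a' q' b' by (simp add: muscl_scheme_def matrix_vector_mult_def)
    then show ?thesis by (simp add: comb_def sum.distrib)
  qed
  have "((\<lambda>k. \<Sum>l\<in>UNIV. comb l (g 2 l k) (g 1 l k) (g 0 l k) (g (- 1) l k) (g (- 2) l k))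
      has_sum (\<Sum>l\<in>UNIV. comb l (G 2 l) (G 1 l) (G 0 l) (G (- 1) l) (G (- 2) l))) UNIV"
    unfolding sum_2 by (rule has_sum_add[OF h h])
  moreover have "(\<Sum>l\<in>UNIV. comb l (g 2 l k) (g 1 l k) (g 0 l k) (g (- 1) l k) (g (- 2) l k))
      = cis (of_int k * \<theta>) * complex_of_real (muscl_scheme A B Q dx dt v k $ i)" for k
    unfolding muscl g_def comb_mult sum_distrib_left ..
  ultimately have "lattice_fourier (muscl_scheme A B Q dx dt v) \<theta> $ i
      = (\<Sum>l\<in>UNIV. comb l (G 2 l) (G 1 l) (G 0 l) (G (- 1) l) (G (- 2) l))"
    by (simp add: lattice_fourier_def infsumI)
  also have "\<dots> = (\<Sum>l\<in>UNIV. F l * comb l (cis (- 2 * \<theta>)) (cis (- \<theta>)) 1 (cis \<theta>) (cis (2 * \<theta>)))"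
    unfolding comb_mult[symmetric] G_def by (simp add: mult.commute)
  also have "\<dots> = (muscl_multiplier A B Q dx dt \<theta> *v lattice_fourier v \<theta>) $ i"
    by (simp add: muscl_multiplier_def matrix_vector_mult_def comb_def a_def q_def b_def F_def
        mult.commute)
  finally show "lattice_fourier (muscl_scheme A B Q dx dt v) \<theta> $ i
      = (muscl_multiplier A B Q dx dt \<theta> *v lattice_fourier v \<theta>) $ i" .
qed

lemma fourier_symbol_muscl_multiplier:
  "fourier_symbol (muscl_scheme A B Q dx dt) \<theta> = muscl_multiplier A B Q dx dt \<theta>"
proof -
  have "lattice_fourier (muscl_scheme A B Q dx dt (\<lambda>k. if k = 0 then axis l 1 else 0)) \<theta> $ i
      = muscl_multiplier A B Q dx dt \<theta> $ i $ l" for i l :: 2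
  proof -
    let ?e = "\<lambda>k::int. if k = 0 then axis l 1 else 0 :: real^2"
    have "(\<lambda>k. norm (?e k)) summable_on UNIV"
      by (rule summable_on_cong_neutral[THEN iffD1, of UNIV "{0}"]) auto
    moreover have "lattice_fourier ?e \<theta> = axis l 1"
    proof (subst vec_eq_iff, intro allI)
      fix m :: 2
      have "(\<Sum>\<^sub>\<infinity>k. cis (of_int k * \<theta>) * complex_of_real (?e k $ m))
          = (\<Sum>\<^sub>\<infinity>k\<in>{0}. cis (of_int k * \<theta>) * complex_of_real (?e k $ m))"
        by (rule infsum_cong_neutral) auto
      then show "lattice_fourier ?e \<theta> $ m = axis l 1 $ m"
        by (simp add: lattice_fourier_def axis_def)
    qed
    ultimately show ?thesis
      by (simp add: lattice_fourier_muscl_multiplier matrix_vector_mult_def axis_def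
          if_distrib cong: if_cong)
  qed
  then show ?thesis by (simp add: fourier_symbol_def vec_eq_iff)
qed

lemma lattice_fourier_muscl_scheme:
  fixes v :: "int \<Rightarrow> real^2"
  assumes "(\<lambda>k. norm (v k)) summable_on UNIV"
  shows "lattice_fourier (muscl_scheme A B Q dx dt v) \<theta>
       = fourier_symbol (muscl_scheme A B Q dx dt) \<theta> *v lattice_fourier v \<theta>"
  by (simp add: fourier_symbol_muscl_multiplier lattice_fourier_muscl_multiplier assms)

lemma fourier_symbol_muscl_scheme:
  assumes dx: "0 < dx" and xi: "\<xi> \<in> {- 2 / dx..2 / dx}"
  shows "fourier_symbol (muscl_scheme A B Q dx dt) (2 * arcsin (\<xi> * dx / 2)) $ i $ l
       = \<i> * of_real \<xi> * ek_M A B Q dt \<xi> dx $ i $ l"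
proof -
  define s where "s = \<xi> * dx / 2"
  define z where "z = sqrt (1 - s\<^sup>2)"
  define t where "t = arcsin s"
  have s: "- 1 \<le> s" "s \<le> 1"
    using dx xi by (auto simp: s_def field_simps)
  have st: "sin t = s" and ct: "cos t = z"
    using s by (simp_all add: t_def z_def cos_arcsin)
  have z2: "z\<^sup>2 = 1 - s\<^sup>2"
    using s by (simp add: z_def abs_square_le_1)
  have \<xi>: "\<xi> = 2 * s / dx" using dx by (simp add: s_def)
  have zeta: "sqrt (1 - (\<xi> * dx)\<^sup>2 / 4) = z"
    by (simp add: z_def s_def power_divide)
  have s2: "sin (2 * t) = 2 * s * z" by (simp add: sin_double st ct)
  have c2: "cos (2 * t) = 1 - 2 * s\<^sup>2" by (simp add: cos_double_sin st)
  have s4: "sin (4 * t) = 4 * s * z * (1 - 2 * s\<^sup>2)"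
    using sin_double[of "2 * t"] by (simp add: s2 c2)
  have c4: "cos (4 * t) = 1 - 8 * s\<^sup>2 + 8 * s ^ 4"
    using cos_double[of "2 * t"] z2 by (simp add: s2 c2 power_mult_distrib)
      (simp add: power2_eq_square power4_eq_xxxx algebra_simps)
  have "muscl_multiplier A B Q dx dt (2 * t) $ i $ l = \<i> * of_real \<xi> * ek_M A B Q dt \<xi> dx $ i $ l"
  proof (rule complex_eqI)
    show "Re (muscl_multiplier A B Q dx dt (2 * t) $ i $ l)
        = Re (\<i> * of_real \<xi> * ek_M A B Q dt \<xi> dx $ i $ l)"
      using dx by (simp add: muscl_multiplier_def ek_M_def zeta c2 c4)
        (simp add: \<xi> field_simps power2_eq_square power4_eq_xxxx)
    show "Im (muscl_multiplier A B Q dx dt (2 * t) $ i $ l)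
        = Im (\<i> * of_real \<xi> * ek_M A B Q dt \<xi> dx $ i $ l)"
      using dx by (simp add: muscl_multiplier_def ek_M_def zeta s2 s4)
        (simp add: \<xi> field_simps power2_eq_square power3_eq_cube)
  qed
  then show ?thesis
    by (simp add: fourier_symbol_muscl_multiplier t_def s_def)
qed

end

(* The Crank--Nicolson map sends an eigenvalue z of the symbol to (1 + dt z/2) / (1 - dt z/2),
   which lies in the closed unit disc whenever Re z <= 0.  The symbol is i X - r Id, where r >= 0
   is the contribution of Q and X is a real 2 x 2 matrix whose characteristic polynomial has
   nonnegative discriminant; hence its eigenvalues all have real part -r. *)

theory Submission
  imports Defs
begin

lemma scaleR_matrix_vector_mult:
  fixes S :: "complex^'n^'m"
  shows "(a *\<^sub>R S) *v w = of_real a *s (S *v w)"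
  by (simp add: vec_eq_iff matrix_vector_mult_def sum_distrib_left)
    (simp add: scaleR_conv_of_real mult.assoc)

lemma matrix_mult_matrix_inv:
  assumes "invertible P"
  shows "P ** matrix_inv P = mat 1"
  using someI_ex[OF assms[unfolded invertible_def]] by (simp add: matrix_inv_def)

lemma cn_implicit_part_mult_vec:
  "cn_implicit_part dt S *v w = w - of_real (dt / 2) *s (S *v w)"
  by (simp add: cn_implicit_part_def matrix_vector_mult_diff_rdistrib scaleR_matrix_vector_mult
      del: of_real_divide)

text \<open>A kernel vector of Id - (dt/2) S would be an eigenvector of \<open>S\<close> for 2/dt, a
  positive number.\<close>

lemma invertible_cn_implicit_part:
  assumes dt: "0 < dt" and S: "\<And>z. is_eigenvalue S z \<Longrightarrow> Re z \<le> 0"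
  shows "invertible (cn_implicit_part dt S)"
proof -
  have "w = 0" if "cn_implicit_part dt S *v w = 0" for w
  proof (rule ccontr)
    assume "w \<noteq> 0"
    have "w = of_real (dt / 2) *s (S *v w)"
      using that by (simp add: cn_implicit_part_mult_vec)
    then have "of_real (2 / dt) *s w = S *v w"
      using dt by (metis (no_types, lifting) vector_smult_assoc of_real_mult of_real_1
          vector_smult_lid nonzero_divide_eq_eq times_divide_eq_left times_divide_eq_right
          less_irrefl divide_self_if zero_neq_numeral)
    then have "is_eigenvalue S (of_real (2 / dt))"
      using \<open>w \<noteq> 0\<close> unfolding is_eigenvalue_def by metis
    then have "2 / dt \<le> 0"
      using S by fastforce
    then show False
      using dt by (simp add: divide_le_0_iff)
  qed
  then show ?thesis
    by (metis matrix_left_invertible_ker invertible_left_inverse)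
qed

text \<open>The inverse Cayley transform sends the closed left half-plane back to the disc: the real
  part in question has the sign of |\<mu>|^2 - 1.\<close>

lemma cmod_le_1_if_Re_cayley_le_0:
  assumes "\<mu> \<noteq> - 1" and "Re ((\<mu> - 1) / (\<mu> + 1)) \<le> 0"
  shows "cmod \<mu> \<le> 1"
proof -
  have "Re ((\<mu> - 1) / (\<mu> + 1)) = ((cmod \<mu>)\<^sup>2 - 1) / (cmod (\<mu> + 1))\<^sup>2"
    by (simp add: Re_divide cmod_power2) (simp add: power2_eq_square algebra_simps)
  moreover have "0 < (cmod (\<mu> + 1))\<^sup>2"
    using assms(1) by (simp add: add_eq_0_iff2)
  ultimately have "(cmod \<mu>)\<^sup>2 \<le> 1"
    using assms(2) by (simp add: divide_le_0_iff)
  then show ?thesis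
    by (simp add: abs_square_le_1)
qed

text \<open>Multiplying the eigenvalue equation by the implicit part clears the inverse. Solving for
  \<open>S *v w\<close> then shows that the same \<open>w\<close> is an eigenvector of
  \<open>S\<close>, for the inverse Cayley transform of \<mu> scaled by 2/dt.\<close>

lemma cn_amplification_eigenvalue_le_1:
  assumes dt: "0 < dt" and S: "\<And>z. is_eigenvalue S z \<Longrightarrow> Re z \<le> 0"
    and \<mu>: "is_eigenvalue (cn_amplification dt S) \<mu>"
  shows "cmod \<mu> \<le> 1"
proof -
  obtain w where w: "w \<noteq> 0" and G: "cn_amplification dt S *v w = \<mu> *s w"
    using \<mu> by (auto simp: is_eigenvalue_def)
  let ?P = "cn_implicit_part dt S"
  have "?P ** matrix_inv ?P = mat 1"
    using invertible_cn_implicit_part[OF dt S] by (rule matrix_mult_matrix_inv)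
  then have "?P *v (cn_amplification dt S *v w) = (mat 1 + (dt / 2) *\<^sub>R S) *v w"
    by (simp add: cn_amplification_def matrix_vector_mul_assoc matrix_mul_assoc)
  then have eq: "\<mu> *s w - of_real (dt / 2) *s (\<mu> *s (S *v w)) = w + of_real (dt / 2) *s (S *v w)"
    by (simp add: G cn_implicit_part_mult_vec matrix_vector_mult_add_rdistrib
        scaleR_matrix_vector_mult vector_scalar_commute mult.commute del: of_real_divide)
  then have comp: "(\<mu> - 1) * w $ i = of_real (dt / 2) * (\<mu> + 1) * (S *v w) $ i" for i
    by (simp add: vec_eq_iff algebra_simps)
  \<comment> \<open>At \<mu> = -1 the right side of \<open>comp\<close> vanishes while the left side
    is -2 times a component of \<open>w\<close>.\<close>
  have "\<mu> \<noteq> - 1"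
    using comp w by (auto simp: vec_eq_iff)
  then have "\<mu> + 1 \<noteq> 0"
    by (simp add: add_eq_0_iff2)
  have "(S *v w) $ i = of_real (2 / dt) * ((\<mu> - 1) / (\<mu> + 1)) * w $ i" for i
  proof -
    have "of_real (2 / dt) * ((\<mu> - 1) / (\<mu> + 1)) * w $ i
        = of_real (2 / dt) / (\<mu> + 1) * ((\<mu> - 1) * w $ i)"
      by simp
    also have "\<dots> = (S *v w) $ i"
      unfolding comp using dt \<open>\<mu> + 1 \<noteq> 0\<close> by simp
    finally show ?thesis ..
  qed
  then have "S *v w = (of_real (2 / dt) * ((\<mu> - 1) / (\<mu> + 1))) *s w"
    by (simp add: vec_eq_iff)
  then have "Re (of_real (2 / dt) * ((\<mu> - 1) / (\<mu> + 1))) \<le> 0"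
    using w by (intro S) (auto simp: is_eigenvalue_def)
  then have "2 / dt * Re ((\<mu> - 1) / (\<mu> + 1)) \<le> 0"
    by (simp only: Re_complex_of_real times_complex.sel Im_complex_of_real mult_zero_left diff_zero)
  then have "Re ((\<mu> - 1) / (\<mu> + 1)) \<le> 0"
    using dt by (simp only: mult_le_0_iff) (auto simp: divide_le_0_iff)
  with \<open>\<mu> \<noteq> - 1\<close> show ?thesis
    by (rule cmod_le_1_if_Re_cayley_le_0)
qed

text \<open>The imaginary part of the square is 2 Re z Im z, so z is real or purely imaginary; a
  nonzero real z would have a positive square.\<close>

lemma Re_eq_0_if_square_eq_neg_real:
  assumes "z\<^sup>2 = - complex_of_real k" and "0 \<le> k"
  shows "Re z = 0"
proof -
  have "(Re z)\<^sup>2 - (Im z)\<^sup>2 = - k" and "Re z = 0 \<or> Im z = 0"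
    using arg_cong[OF assms(1), of Re] arg_cong[OF assms(1), of Im]
    by (auto simp: power2_eq_square)
  then show ?thesis
    using assms(2) by (smt (verit) zero_less_power2 zero_power2)
qed

text \<open>Here X has rows (0, p) and (g, 2h), and its characteristic polynomial has discriminant 4
  (h^2 + p g). The shift \<open>v\<close> removes the damping -r, which leaves an eigenvalue of i
  X.\<close>

lemma Re_eigenvalue_shifted_companion:
  assumes "S $ 1 $ 1 = - of_real r" and "S $ 1 $ 2 = \<i> * of_real p"
    and "S $ 2 $ 1 = \<i> * of_real g" and "S $ 2 $ 2 = - of_real r + \<i> * of_real (2 * h)"
    and disc: "0 \<le> h\<^sup>2 + p * g"
    and "is_eigenvalue S z"
  shows "Re z = - r"
proof -
  obtain w where w: "w \<noteq> 0" and eig: "S *v w = z *s w"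
    using assms(6) by (auto simp: is_eigenvalue_def)
  define v where "v = z + of_real r"
  have e1: "v * w $ 1 = \<i> * of_real p * w $ 2"
    and e2: "(v - \<i> * of_real (2 * h)) * w $ 2 = \<i> * of_real g * w $ 1"
    using eig assms(1-4)
    by (auto simp: v_def vec_eq_iff forall_2 matrix_vector_mult_def sum_2 algebra_simps)
  \<comment> \<open>This is det(i X - v Id). Eliminating either component of \<open>w\<close> from
    \<open>e1\<close> and \<open>e2\<close> shows that it annihilates the other one.\<close>
  let ?ch = "v * (v - \<i> * of_real (2 * h)) + of_real (p * g)"
  have "?ch * w $ 1 = 0" "?ch * w $ 2 = 0"
    using e1 e2 i_squared unfolding of_real_mult by algebra+
  then have "?ch = 0"
    using w unfolding vec_eq_iff forall_2 mult_eq_0_iff by auto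
  \<comment> \<open>Completing the square turns \<open>disc\<close> into the sign condition of the
    previous lemma.\<close>
  then have "(v - \<i> * of_real h)\<^sup>2 = - of_real (h\<^sup>2 + p * g)"
    by (simp add: power2_eq_square algebra_simps add_eq_0_iff)
  from Re_eq_0_if_square_eq_neg_real[OF this disc] show ?thesis
    by (simp add: v_def)
qed

lemma Re_eigenvalue_muscl_symbol_le_0:
  assumes "0 \<le> \<sigma>" and dx: "0 < dx" and dt: "0 < dt" and a: "0 \<le> a"
    and xi: "\<xi> \<in> {- 2 / dx..2 / dx}"
    and ev: "is_eigenvalue (fourier_symbol
      (muscl_scheme (ek_A c u) (ek_B \<sigma>) (a *\<^sub>R mat 1) dx dt) (2 * arcsin (\<xi> * dx / 2))) z"
  shows "Re z \<le> 0"
proof -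
  define \<zeta> where "\<zeta> = sqrt (1 - (\<xi> * dx)\<^sup>2 / 4)"
  define m where "m = 1 + \<xi>\<^sup>2 * dx\<^sup>2 / 4"
  define p where "p = \<xi> * \<zeta> * m"
  define g where "g = p * (c\<^sup>2 - u\<^sup>2) + \<xi> ^ 3 * \<zeta> * \<sigma>"
  \<comment> \<open>The factor i \<xi> in front of M meets the i \<xi> of the Q term, so Q enters
    the symbol as the real damping -r Id.\<close>
  define r where "r = \<xi> ^ 4 * dx ^ 4 / (16 * dt) * a"
  define S where "S = fourier_symbol
    (muscl_scheme (ek_A c u) (ek_B \<sigma>) (a *\<^sub>R mat 1) dx dt) (2 * arcsin (\<xi> * dx / 2))"
  have entry: "S $ i $ l = \<i> * of_real (\<xi> * (\<zeta> * (m * ek_A c u $ i $ l + \<xi>\<^sup>2 * ek_B \<sigma> $ i $ l)))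
      - of_real (r * mat 1 $ i $ l)" for i l
    unfolding S_def fourier_symbol_muscl_scheme[OF dx xi] ek_M_def Let_def \<zeta>_def[symmetric]
      m_def[symmetric] r_def
    by (rule complex_eqI) (simp_all add: power2_eq_square power4_eq_xxxx)
  have "S $ 1 $ 1 = - of_real r" "S $ 1 $ 2 = \<i> * of_real p"
    "S $ 2 $ 1 = \<i> * of_real g" "S $ 2 $ 2 = - of_real r + \<i> * of_real (2 * (u * p))"
    unfolding entry ek_A_def ek_B_def mat_def p_def g_def
    by (simp_all add: algebra_simps power2_eq_square power3_eq_cube)
  moreover have "0 \<le> (u * p)\<^sup>2 + p * g"
  proof -
    \<comment> \<open>With h = u p, the -u^2 inside \<open>g\<close> cancels (u p)^2. What is left
      is a sound-speed square plus a capillary term, nonnegative because m is at least 1.\<close>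
    have "(u * p)\<^sup>2 + p * g = (p * c)\<^sup>2 + (\<xi>\<^sup>2 * \<zeta>)\<^sup>2 * m * \<sigma>"
      by (simp add: p_def g_def power2_eq_square power3_eq_cube algebra_simps)
    also have "\<dots> \<ge> 0"
      using \<open>0 \<le> \<sigma>\<close> by (simp add: m_def)
    finally show ?thesis .
  qed
  ultimately have "Re z = - r"
    using ev[folded S_def] by (rule Re_eigenvalue_shifted_companion)
  moreover have "0 \<le> r"
    using dt a by (simp add: r_def)
  ultimately show ?thesis
    by simp
qed

theorem proposition2p7:
  fixes \<rho> u c \<sigma> dx dt lam\<^sub>1 :: real
  assumes "0 < \<rho>" and "0 < c" and "0 < \<sigma>" and "0 < dx" and "0 < dt"
    and "lam\<^sub>1 = dt / dx"
  shows "\<forall>q::real. q \<ge> 0 \<longrightarrow>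
    cn_von_neumann_stable dx dt
      (muscl_scheme (ek_A c u) (ek_B \<sigma>) ((lam\<^sub>1 * q) *\<^sub>R mat 1) dx dt)"
proof (intro allI impI)
  fix q :: real
  assume "0 \<le> q"
  then have "0 \<le> lam\<^sub>1 * q"
    using assms by simp
  then have "Re z \<le> 0"
    if "\<xi> \<in> {- 2 / dx..2 / dx}"
      and "is_eigenvalue (fourier_symbol
        (muscl_scheme (ek_A c u) (ek_B \<sigma>) ((lam\<^sub>1 * q) *\<^sub>R mat 1) dx dt)
        (2 * arcsin (\<xi> * dx / 2))) z" for \<xi> z
    using that assms by (intro Re_eigenvalue_muscl_symbol_le_0[of \<sigma> dx dt]) auto
  then show "cn_von_neumann_stable dx dt
      (muscl_scheme (ek_A c u) (ek_B \<sigma>) ((lam\<^sub>1 * q) *\<^sub>R mat 1) dx dt)"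
    \<comment> \<open>The half-plane bound on the symbol yields both halves of stability:
      invertibility of the implicit part and the modulus bound.\<close>
    unfolding cn_von_neumann_stable_def Let_def
    by (intro ballI conjI allI impI invertible_cn_implicit_part[OF \<open>0 < dt\<close>]
        cn_amplification_eigenvalue_le_1[OF \<open>0 < dt\<close>])
qed

end
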